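(* Let $D=(F,R,>)$ be a defeasible theory and $E(D)=\langle\partial^+,\partial^-,\partial^{+\mathsf{O}},\partial^{-\mathsf{O}},\partial^{+\wedge},\partial^{-\wedge}\rangle$ its extension. Then $E(D)$ is coherent, i.e. $\partial^+\cap\partial^-=\emptyset$, $\partial^{+\mathsf{O}}\cap\partial^{-\mathsf{O}}=\emptyset$ and $\partial^{+\wedge}\cap\partial^{-\wedge}=\emptyset$. Moreover, if $F$ does not contain a pair of complementary literals and the transitive closure of $>$ is acyclic, then $E(D)$ is consistent, i.e. neither $\partial^+$ nor $\partial^{+\mathsf{O}}$ contains both a literal $p$ and its complement $\sim p$.
   Context: Language. Literals are propositional atoms $p$ and their negations $\neg p$; $\sim q$ is the complement of $q$. Deontic literals are $\mathsf{O} l$, $\neg\mathsf{O} l$ ($l$ a literal). A conjunctive obligation is $\mathsf{O}(c_1\wedge\dots\wedge c_m)$ with literals $c_i$. A $\otimes$-expression is $c_1\otimes\dots\otimes c_k$ of literals; $c_j$ has index $j$. A rule $r$ has a finite antecedent $A(r)$ of literals, deontic literals and conjunctive obligations, an arrow among $\Rightarrow$ (constitutive defeasible), $\Rightarrow_{\mathsf{O}}$ (prescriptive defeasible), $\leadsto$ (constitutive defeater), $\leadsto_{\mathsf{O}}$ (prescriptive defeater), and a consequent $C(r)$: a literal for defeaters and constitutive rules, a $\otimes$-expression for prescriptive defeasible rules. For a rule set $R$: $R_d$ defeasible rules, $R^{\mathsf{O}}$ prescriptive, $R^C$ constitutive, $R[q,n]$ rules with $q$ at index $n$ of the consequent, $R[q]=\bigcup_nR[q,n]$,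 with combinations. A defeasible theory is $D=(F,R,>)$: $F$ a set of literals, $R$ a finite set of rules, $>$ a binary relation on $R$. For a set $L$ of literals, the reduct $\mathit{red}(D,L)=(F\setminus L, R\setminus\bigcup_{l\in L}R[l], >')$ with $>'$ the restriction of $>$ to remaining rules. Extensions. An extension-tuple is $E=\langle\partial^+,\partial^-,\partial^{+\mathsf{O}},\partial^{-\mathsf{O}},\partial^{+\wedge},\partial^{-\wedge}\rangle$ (first four: sets of literals; last two: sets of conjunctions of literals). For a rule $r$ let $r^\#=\{l: l\in A(r)\}$, $r^{\mathsf{O}}=\{l:\mathsf{O} l\in A(r)\}$, $r^{\mathsf{P}}=\{l:\neg\mathsf{O} l\in A(r)\}$, $r^\wedge=\{c:\mathsf{O}(c)\in A(r)\}$. $r$ is body-applicable in $E$ iff $r^\#\subseteq\partial^+$, $r^{\mathsf{O}}\subseteq\partial^{+\mathsf{O}}$, $r^{\mathsf{P}}\subseteq\partial^{-\mathsf{O}}$, $r^\wedge\subseteq\partial^{+\wedge}$; body-discarded iff $r^\#\cap\partial^-$, $r^{\mathsf{O}}\cap\partial^{-\mathsf{O}}$, $r^{\mathsf{P}}\cap\partial^{+\mathsf{O}}$ or $r^\wedge\cap\partial^{-\wedge}$ is nonempty. A constitutive rule is applicable/discarded in $E$ iff body-applicable/body-discarded. A prescriptive rule with $C(r)=c_1\otimes\dots\otimes c_m$ is applicable in $E$ for $q=c_j$ at index $j$ iff it is body-applicable and for all $k<j$, $c_k\in\partial^{+\mathsf{O}}$ and $\sim c_k\in\partial^+$; discarded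 for $q$ at index $j$ iff body-discarded or for some $k<j$, $c_k\in\partial^{-\mathsf{O}}$ or $\sim c_k\in\partial^-$. Construction: $E_0=\langle F,\emptyset,\emptyset,\emptyset,\emptyset,\emptyset\rangle$ and $E_{n+1}$ is obtained by adding to each component of $E_n$: to $\partial^+$: all $q$ with $\sim q\notin F$, some $r\in R^C_d[q]$ applicable in $E_n$, and every $s\in R^C[\sim q]$ discarded in $E_n$ or beaten by some $t\in R^C[q]$ applicable in $E_n$ with $t>s$; to $\partial^-$: all $q\notin F$ such that $\sim q\in F$, or every $r\in R^C_d[q]$ is discarded in $E_n$, or some $s\in R^C[\sim q]$ is applicable in $E_n$ with every $t\in R^C[q]$ discarded in $E_n$ or $t\not>s$; to $\partial^{+\mathsf{O}}$: all $q$ such that some $r\in R^{\mathsf{O}}_d[q,j]$ is applicable in $E_n$ for $q$ at $j$ and every $s\in R^{\mathsf{O}}[\sim q,k]$ is discarded in $E_n$ for $\sim q$ at $k$ or there is $t\in R^{\mathsf{O}}[q,i]$ applicable in $E_n$ with $t>s$; to $\partial^{-\mathsf{O}}$: all $q$ such that every $r\in R^{\mathsf{O}}_d[q,j]$ is discarded in $E_n$, or some $s\in R^{\mathsf{O}}[\sim q,k]$ is applicable in $E_n$ such that every $t\in R^{\mathsf{O}}[q,i]$ is discarded in $E_n$ or $t\not> s$; to $\partial^{+\wedge}$: all $c_1\wedge\dots\wedge c_m$ (conjuncts occurring in $D$) such that for every $i$, $c_i\in\partial^{+\mathsf{O}}_n$ and $c_i\in\partial^{+\mathsf{O}}(\mathit{red}(D,C\setminus\{\sim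 c_i\}))$, where $C=\{\sim c_1,\dots,\sim c_m\}$ and $\partial^{+\mathsf{O}}(D')$ is the third component of the extension $E(D')$ of $D'$ defined by this same construction; to $\partial^{-\wedge}$: all $c_1\wedge\dots\wedge c_m$ such that for some $i$, $c_i\in\partial^{-\mathsf{O}}_n$ or $c_i\notin\partial^{+\mathsf{O}}(\mathit{red}(D,C\setminus\{\sim c_i\}))$. The extension $E(D)$ is the componentwise union (limit) of $E_0\subseteq E_1\subseteq\cdots$.
   Formalization: The definition of E(D) is circular, as a reduct may be D itself, and for some theories (rules ⇒_O a, ⇒_O b, O(a∧b) ⇒_O ¬a) no E(D) exists; the result is stated for every E that solves the defining equations of D and its iterated reducts. *)

theory Defs
  imports Main
begin

datatype 'a literal = Pos 'a | Neg 'a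

fun compl :: "'a literal \<Rightarrow> 'a literal" where
  "compl (Pos p) = Neg p"
| "compl (Neg p) = Pos p"

text \<open>
  A conjunction \<open>c\<^sub>1 \<and> \<dots> \<and> c\<^sub>m\<close> (\<open>m \<ge> 1\<close>) and an \<open>\<otimes>\<close>-expression \<open>c\<^sub>1 \<otimes> \<dots> \<otimes> c\<^sub>k\<close> (\<open>k \<ge> 1\<close>) are both
  non-empty lists of literals. A consequent that is a single literal is a one-element list.
\<close>

datatype 'a condition =
    Lit "'a literal"
  | Obl "'a literal"
  | NotObl "'a literal"
  | OblConj "'a literal list"

datatype arrow =
    Constitutive_Defeasible
  | Prescriptive_Defeasible
  | Constitutive_Defeater
  | Prescriptive_Defeater

record 'a rule =
  antecedent :: "'a condition set"
  arrow :: arrow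
  consequent :: "'a literal list"

definition wf_rule :: "'a rule \<Rightarrow> bool" where
  "wf_rule r \<longleftrightarrow>
     finite (antecedent r) \<and> OblConj [] \<notin> antecedent r \<and> consequent r \<noteq> [] \<and>
     (arrow r \<noteq> Prescriptive_Defeasible \<longrightarrow> length (consequent r) = 1)"

record 'a dtheory =
  facts :: "'a literal set"
  rules :: "'a rule set"
  superior :: "('a rule \<times> 'a rule) set"

text \<open>\<open>(t, s) \<in> superior D\<close> renders \<open>t > s\<close>.\<close>

definition defeasible_theory :: "'a dtheory \<Rightarrow> bool" where
  "defeasible_theory D \<longleftrightarrow>
     finite (rules D) \<and> (\<forall>r\<in>rules D. wf_rule r) \<and> superior D \<subseteq> rules D \<times> rules D"

definition defeasible :: "'a rule set \<Rightarrow> 'a rule set" where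
  "defeasible R = {r \<in> R. arrow r \<in> {Constitutive_Defeasible, Prescriptive_Defeasible}}"

definition prescriptive :: "'a rule set \<Rightarrow> 'a rule set" where
  "prescriptive R = {r \<in> R. arrow r \<in> {Prescriptive_Defeasible, Prescriptive_Defeater}}"

definition constitutive :: "'a rule set \<Rightarrow> 'a rule set" where
  "constitutive R = {r \<in> R. arrow r \<in> {Constitutive_Defeasible, Constitutive_Defeater}}"

text \<open>Indices in a consequent start at 1.\<close>

definition rules_at :: "'a rule set \<Rightarrow> 'a literal \<Rightarrow> nat \<Rightarrow> 'a rule set" where
  "rules_at R q n = {r \<in> R. 1 \<le> n \<and> n \<le> length (consequent r) \<and> consequent r ! (n - 1) = q}"

definition rules_for :: "'a rule set \<Rightarrow> 'a literal \<Rightarrow> 'a rule set" where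
  "rules_for R q = (\<Union>n. rules_at R q n)"

definition red :: "'a dtheory \<Rightarrow> 'a literal set \<Rightarrow> 'a dtheory" where
  "red D L =
     (let R' = rules D - (\<Union>l\<in>L. rules_for (rules D) l)
      in \<lparr>facts = facts D - L, rules = R', superior = superior D \<inter> (R' \<times> R')\<rparr>)"

text \<open>The reduct against which the conjunct \<open>l\<close> of the conjunction \<open>c\<close> is tested.\<close>

definition conj_red :: "'a dtheory \<Rightarrow> 'a literal list \<Rightarrow> 'a literal \<Rightarrow> 'a dtheory" where
  "conj_red D c l = red D (compl ` set c - {compl l})"

fun condition_literals :: "'a condition \<Rightarrow> 'a literal set" where
  "condition_literals (Lit l) = {l}"
| "condition_literals (Obl l) = {l}"
| "condition_literals (NotObl l) = {l}"
| "condition_literals (OblConj c) = set c"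

definition literals_of :: "'a dtheory \<Rightarrow> 'a literal set" where
  "literals_of D =
     facts D \<union>
     (\<Union>r\<in>rules D. (\<Union>a\<in>antecedent r. condition_literals a) \<union> set (consequent r))"

record 'a extension =
  pos :: "'a literal set"
  neg :: "'a literal set"
  posO :: "'a literal set"
  negO :: "'a literal set"
  posConj :: "'a literal list set"
  negConj :: "'a literal list set"

definition body_applicable :: "'a extension \<Rightarrow> 'a rule \<Rightarrow> bool" where
  "body_applicable E r \<longleftrightarrow>
     {l. Lit l \<in> antecedent r} \<subseteq> pos E \<and>
     {l. Obl l \<in> antecedent r} \<subseteq> posO E \<and>
     {l. NotObl l \<in> antecedent r} \<subseteq> negO E \<and>
     {c. OblConj c \<in> antecedent r} \<subseteq> posConj E"

definition body_discarded :: "'a extension \<Rightarrow> 'a rule \<Rightarrow> bool" where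
  "body_discarded E r \<longleftrightarrow>
     {l. Lit l \<in> antecedent r} \<inter> neg E \<noteq> {} \<or>
     {l. Obl l \<in> antecedent r} \<inter> negO E \<noteq> {} \<or>
     {l. NotObl l \<in> antecedent r} \<inter> posO E \<noteq> {} \<or>
     {c. OblConj c \<in> antecedent r} \<inter> negConj E \<noteq> {}"

definition applicable_at :: "'a extension \<Rightarrow> 'a rule \<Rightarrow> nat \<Rightarrow> bool" where
  "applicable_at E r j \<longleftrightarrow>
     body_applicable E r \<and>
     (\<forall>k. 1 \<le> k \<and> k < j \<longrightarrow>
        consequent r ! (k - 1) \<in> posO E \<and> compl (consequent r ! (k - 1)) \<in> pos E)"

definition discarded_at :: "'a extension \<Rightarrow> 'a rule \<Rightarrow> nat \<Rightarrow> bool" where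
  "discarded_at E r j \<longleftrightarrow>
     body_discarded E r \<or>
     (\<exists>k. 1 \<le> k \<and> k < j \<and>
        (consequent r ! (k - 1) \<in> negO E \<or> compl (consequent r ! (k - 1)) \<in> neg E))"

definition new_pos :: "'a dtheory \<Rightarrow> 'a extension \<Rightarrow> 'a literal set" where
  "new_pos D E =
     {q. compl q \<notin> facts D \<and>
         (\<exists>r \<in> rules_for (constitutive (defeasible (rules D))) q. body_applicable E r) \<and>
         (\<forall>s \<in> rules_for (constitutive (rules D)) (compl q).
            body_discarded E s \<or>
            (\<exists>t \<in> rules_for (constitutive (rules D)) q.
               body_applicable E t \<and> (t, s) \<in> superior D))}"

definition new_neg :: "'a dtheory \<Rightarrow> 'a extension \<Rightarrow> 'a literal set" where
  "new_neg D E =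
     {q. q \<notin> facts D \<and>
         (compl q \<in> facts D \<or>
          (\<forall>r \<in> rules_for (constitutive (defeasible (rules D))) q. body_discarded E r) \<or>
          (\<exists>s \<in> rules_for (constitutive (rules D)) (compl q).
             body_applicable E s \<and>
             (\<forall>t \<in> rules_for (constitutive (rules D)) q.
                body_discarded E t \<or> (t, s) \<notin> superior D)))}"

definition new_posO :: "'a dtheory \<Rightarrow> 'a extension \<Rightarrow> 'a literal set" where
  "new_posO D E =
     {q. (\<exists>j. \<exists>r \<in> rules_at (prescriptive (defeasible (rules D))) q j. applicable_at E r j) \<and>
         (\<forall>k. \<forall>s \<in> rules_at (prescriptive (rules D)) (compl q) k.
            discarded_at E s k \<or>
            (\<exists>i. \<exists>t \<in> rules_at (prescriptive (rules D)) q i.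
               applicable_at E t i \<and> (t, s) \<in> superior D))}"

definition new_negO :: "'a dtheory \<Rightarrow> 'a extension \<Rightarrow> 'a literal set" where
  "new_negO D E =
     {q. (\<forall>j. \<forall>r \<in> rules_at (prescriptive (defeasible (rules D))) q j. discarded_at E r j) \<or>
         (\<exists>k. \<exists>s \<in> rules_at (prescriptive (rules D)) (compl q) k.
            applicable_at E s k \<and>
            (\<forall>i. \<forall>t \<in> rules_at (prescriptive (rules D)) q i.
               discarded_at E t i \<or> (t, s) \<notin> superior D))}"

text \<open>
  In the next definitions \<open>X D'\<close> stands for the extension \<open>E(D')\<close> of a reduct \<open>D'\<close>.
\<close>

definition new_posConj ::
  "('a dtheory \<Rightarrow> 'a extension) \<Rightarrow> 'a dtheory \<Rightarrow> 'a extension \<Rightarrow> 'a literal list set" where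
  "new_posConj X D E =
     {c. c \<noteq> [] \<and> set c \<subseteq> literals_of D \<and>
         (\<forall>l \<in> set c. l \<in> posO E \<and> l \<in> posO (X (conj_red D c l)))}"

definition new_negConj ::
  "('a dtheory \<Rightarrow> 'a extension) \<Rightarrow> 'a dtheory \<Rightarrow> 'a extension \<Rightarrow> 'a literal list set" where
  "new_negConj X D E =
     {c. c \<noteq> [] \<and> (\<exists>l \<in> set c. l \<in> negO E \<or> l \<notin> posO (X (conj_red D c l)))}"

primrec stage ::
  "('a dtheory \<Rightarrow> 'a extension) \<Rightarrow> 'a dtheory \<Rightarrow> nat \<Rightarrow> 'a extension" where
  "stage X D 0 =
     \<lparr>pos = facts D, neg = {}, posO = {}, negO = {}, posConj = {}, negConj = {}\<rparr>"
| "stage X D (Suc n) =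
     (let E = stage X D n in
      \<lparr>pos = pos E \<union> new_pos D E,
       neg = neg E \<union> new_neg D E,
       posO = posO E \<union> new_posO D E,
       negO = negO E \<union> new_negO D E,
       posConj = posConj E \<union> new_posConj X D E,
       negConj = negConj E \<union> new_negConj X D E\<rparr>)"

definition limit_stage ::
  "('a dtheory \<Rightarrow> 'a extension) \<Rightarrow> 'a dtheory \<Rightarrow> 'a extension" where
  "limit_stage X D =
     \<lparr>pos = (\<Union>n. pos (stage X D n)),
      neg = (\<Union>n. neg (stage X D n)),
      posO = (\<Union>n. posO (stage X D n)),
      negO = (\<Union>n. negO (stage X D n)),
      posConj = (\<Union>n. posConj (stage X D n)),
      negConj = (\<Union>n. negConj (stage X D n))\<rparr>"

text \<open>\<open>D\<close> together with all theories whose extensions the construction for \<open>D\<close> refers to,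
  directly or through other reducts.\<close>

inductive_set iterated_reds :: "'a dtheory \<Rightarrow> 'a dtheory set" for D :: "'a dtheory" where
  self: "D \<in> iterated_reds D"
| step: "D' \<in> iterated_reds D \<Longrightarrow> c \<noteq> [] \<Longrightarrow> l \<in> set c \<Longrightarrow> conj_red D' c l \<in> iterated_reds D"

text \<open>
  \<open>E\<close> is the extension \<open>E(D)\<close>: it is the limit of the stages of \<open>D\<close>, where the extensions of
  the reducts are obtained by the same construction. This is stated by simultaneous equations for
  \<open>D\<close> and its iterated reducts rather than by recursion on theories, because a reduct may coincide
  with the theory it is taken from (e.g. \<open>conj_red D [l] l\<close>, or when the removed literals do not
  occur in \<open>D\<close>), so that \<open>E(D)\<close> is then described in terms of \<open>\<partial>\<^sup>+\<^sup>O(D)\<close> itself.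
\<close>

definition is_extension :: "'a dtheory \<Rightarrow> 'a extension \<Rightarrow> bool" where
  "is_extension D E \<longleftrightarrow>
     (\<exists>X. (\<forall>D' \<in> iterated_reds D. X D' = limit_stage X D') \<and> E = X D)"

definition coherent :: "'a extension \<Rightarrow> bool" where
  "coherent E \<longleftrightarrow>
     pos E \<inter> neg E = {} \<and> posO E \<inter> negO E = {} \<and> posConj E \<inter> negConj E = {}"

definition consistent :: "'a extension \<Rightarrow> bool" where
  "consistent E \<longleftrightarrow>
     \<not> (\<exists>p. p \<in> pos E \<and> compl p \<in> pos E) \<and> \<not> (\<exists>p. p \<in> posO E \<and> compl p \<in> posO E)"

text \<open>
  When no literal depends on a conjunctive obligation at its own level, the equations in
  \<open>is_extension\<close> have exactly one solution; in particular (\<open>v = (\<lambda>_. 0)\<close>) when antecedents contain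
  no conjunctive obligations. Without such a condition there may be none: for the rules
  \<open>\<Rightarrow>\<^sub>O a\<close>, \<open>\<Rightarrow>\<^sub>O b\<close>, \<open>O(a \<and> b) \<Rightarrow>\<^sub>O \<not>a\<close> (and no facts or superiority) the reduct testing \<open>a\<close> is the
  theory itself, and \<open>a \<in> \<partial>\<^sup>+\<^sup>O\<close> would hold iff \<open>a \<notin> \<partial>\<^sup>+\<^sup>O\<close>.
\<close>

definition stratified :: "('a literal \<Rightarrow> nat) \<Rightarrow> 'a dtheory \<Rightarrow> bool" where
  "stratified v D \<longleftrightarrow>
     (\<forall>l. v (compl l) = v l) \<and>
     (\<forall>r \<in> rules D. \<forall>j < length (consequent r).
        (\<forall>k < j. v (consequent r ! k) \<le> v (consequent r ! j)) \<and>
        (\<forall>l. Lit l \<in> antecedent r \<or> Obl l \<in> antecedent r \<or> NotObl l \<in> antecedent r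
             \<longrightarrow> v l \<le> v (consequent r ! j)) \<and>
        (\<forall>c. OblConj c \<in> antecedent r \<longrightarrow> (\<forall>l \<in> set c. v l < v (consequent r ! j))))"

lemma stratified_iterated_reds:
  assumes "stratified v D" "D' \<in> iterated_reds D"
  shows "stratified v D'"
  using assms(2)
proof induction
  case (step D' c l)
  have "rules (conj_red D' c l) \<subseteq> rules D'"
    by (auto simp: conj_red_def red_def Let_def)
  with step show ?case unfolding stratified_def by blast
qed (fact assms)

definition agree :: "('a literal \<Rightarrow> nat) \<Rightarrow> nat \<Rightarrow> 'a extension \<Rightarrow> 'a extension \<Rightarrow> bool" where
  "agree v m E E' \<longleftrightarrow>
     (\<forall>q. v q \<le> m \<longrightarrow> (q \<in> pos E \<longleftrightarrow> q \<in> pos E') \<and> (q \<in> neg E \<longleftrightarrow> q \<in> neg E') \<and>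
        (q \<in> posO E \<longleftrightarrow> q \<in> posO E') \<and> (q \<in> negO E \<longleftrightarrow> q \<in> negO E')) \<and>
     (\<forall>c. (\<forall>l \<in> set c. v l < m) \<longrightarrow>
        (c \<in> posConj E \<longleftrightarrow> c \<in> posConj E') \<and> (c \<in> negConj E \<longleftrightarrow> c \<in> negConj E'))"

lemma body_agree:
  assumes "stratified v D" "agree v m E E'" "r \<in> rules_at (rules D) q j" "v q \<le> m"
  shows "body_applicable E r = body_applicable E' r" "body_discarded E r = body_discarded E' r"
proof -
  have j: "r \<in> rules D" "j - 1 < length (consequent r)" "consequent r ! (j - 1) = q"
    using assms(3) by (auto simp: rules_at_def)
  have 1: "v l \<le> m" if "Lit l \<in> antecedent r \<or> Obl l \<in> antecedent r \<or> NotObl l \<in> antecedent r" for l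
    using assms(1,4) j that unfolding stratified_def by (meson le_trans)
  have 2: "v l < m" if "OblConj c \<in> antecedent r" "l \<in> set c" for c l
    using assms(1,4) j that unfolding stratified_def by (meson less_le_trans)
  have L: "l \<in> pos E \<longleftrightarrow> l \<in> pos E'" "l \<in> neg E \<longleftrightarrow> l \<in> neg E'" if "Lit l \<in> antecedent r" for l
    using 1 that assms(2) unfolding agree_def by blast+
  have O: "l \<in> posO E \<longleftrightarrow> l \<in> posO E'" "l \<in> negO E \<longleftrightarrow> l \<in> negO E'"
    if "Obl l \<in> antecedent r \<or> NotObl l \<in> antecedent r" for l
    using 1 that assms(2) unfolding agree_def by blast+
  have C: "c \<in> posConj E \<longleftrightarrow> c \<in> posConj E'" "c \<in> negConj E \<longleftrightarrow> c \<in> negConj E'"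
    if "OblConj c \<in> antecedent r" for c
    using 2 that assms(2) unfolding agree_def by blast+
  show "body_applicable E r = body_applicable E' r"
    unfolding body_applicable_def using L O C by blast
  show "body_discarded E r = body_discarded E' r"
    unfolding body_discarded_def using L O C by blast
qed

lemma at_agree:
  assumes "stratified v D" "agree v m E E'" "r \<in> rules_at (rules D) q j" "v q \<le> m"
  shows "applicable_at E r j = applicable_at E' r j" "discarded_at E r j = discarded_at E' r j"
proof -
  have j: "r \<in> rules D" "j - 1 < length (consequent r)" "consequent r ! (j - 1) = q"
    using assms(3) by (auto simp: rules_at_def)
  have 1: "v (consequent r ! (k - 1)) \<le> m" if "1 \<le> k" "k < j" for k
  proof -
    have "k - 1 < j - 1" using that by simp
    thus ?thesis using assms(1,4) j unfolding stratified_def by (meson le_trans)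
  qed
  have c: "v (compl l) = v l" for l using assms(1) unfolding stratified_def by blast
  have 2: "(consequent r ! (k - 1) \<in> posO E \<longleftrightarrow> consequent r ! (k - 1) \<in> posO E') \<and>
           (consequent r ! (k - 1) \<in> negO E \<longleftrightarrow> consequent r ! (k - 1) \<in> negO E') \<and>
           (compl (consequent r ! (k - 1)) \<in> pos E \<longleftrightarrow> compl (consequent r ! (k - 1)) \<in> pos E') \<and>
           (compl (consequent r ! (k - 1)) \<in> neg E \<longleftrightarrow> compl (consequent r ! (k - 1)) \<in> neg E')"
    if "1 \<le> k" "k < j" for k
    using 1[OF that] c assms(2) unfolding agree_def by simp
  show "applicable_at E r j = applicable_at E' r j" "discarded_at E r j = discarded_at E' r j"
    unfolding applicable_at_def discarded_at_def using 2 body_agree[OF assms] by blast+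
qed

lemma new_agree:
  assumes "stratified v D" "agree v m E E'" "v q \<le> m"
  shows "q \<in> new_pos D E \<longleftrightarrow> q \<in> new_pos D E'" "q \<in> new_neg D E \<longleftrightarrow> q \<in> new_neg D E'"
    "q \<in> new_posO D E \<longleftrightarrow> q \<in> new_posO D E'" "q \<in> new_negO D E \<longleftrightarrow> q \<in> new_negO D E'"
proof -
  have c: "v (compl q) \<le> m" using assms(1,3) by (simp add: stratified_def)
  have sub: "rules_at (constitutive (rules D)) p j \<subseteq> rules_at (rules D) p j"
    "rules_at (prescriptive (rules D)) p j \<subseteq> rules_at (rules D) p j"
    "rules_at (constitutive (defeasible (rules D))) p j \<subseteq> rules_at (rules D) p j"
    "rules_at (prescriptive (defeasible (rules D))) p j \<subseteq> rules_at (rules D) p j" for p j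
    by (auto simp: rules_at_def constitutive_def prescriptive_def defeasible_def)
  note B = body_agree[OF assms(1,2) subsetD[OF sub(1)] assms(3)]
    body_agree[OF assms(1,2) subsetD[OF sub(3)] assms(3)]
    body_agree[OF assms(1,2) subsetD[OF sub(1)] c]
  note A = at_agree[OF assms(1,2) subsetD[OF sub(2)] assms(3)]
    at_agree[OF assms(1,2) subsetD[OF sub(4)] assms(3)]
    at_agree[OF assms(1,2) subsetD[OF sub(2)] c]
  show "q \<in> new_pos D E \<longleftrightarrow> q \<in> new_pos D E'" "q \<in> new_neg D E \<longleftrightarrow> q \<in> new_neg D E'"
    unfolding new_pos_def new_neg_def rules_for_def by (simp_all add: B cong: conj_cong)
  show "q \<in> new_posO D E \<longleftrightarrow> q \<in> new_posO D E'" "q \<in> new_negO D E \<longleftrightarrow> q \<in> new_negO D E'"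
    unfolding new_posO_def new_negO_def by (simp_all add: A cong: conj_cong)
qed

lemma stage_agree:
  assumes "stratified v D"
    and "\<And>c l q. c \<noteq> [] \<Longrightarrow> l \<in> set c \<Longrightarrow> v q < m \<Longrightarrow>
           q \<in> posO (X (conj_red D c l)) \<longleftrightarrow> q \<in> posO (Y (conj_red D c l))"
  shows "agree v m (stage X D n) (stage Y D n)"
proof (induction n)
  case (Suc n)
  have "c \<in> new_posConj X D (stage X D n) \<longleftrightarrow> c \<in> new_posConj Y D (stage Y D n)"
    "c \<in> new_negConj X D (stage X D n) \<longleftrightarrow> c \<in> new_negConj Y D (stage Y D n)"
    if c: "\<forall>l \<in> set c. v l < m" for c
  proof -
    have "(l \<in> posO (stage X D n) \<longleftrightarrow> l \<in> posO (stage Y D n)) \<and>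
        (l \<in> negO (stage X D n) \<longleftrightarrow> l \<in> negO (stage Y D n)) \<and>
        (l \<in> posO (X (conj_red D c l)) \<longleftrightarrow> l \<in> posO (Y (conj_red D c l)))" if l: "l \<in> set c" for l
    proof -
      have "v l < m" "c \<noteq> []" using c l by auto
      with Suc assms(2)[OF _ l] show ?thesis unfolding agree_def by (meson less_imp_le)
    qed
    then show "c \<in> new_posConj X D (stage X D n) \<longleftrightarrow> c \<in> new_posConj Y D (stage Y D n)"
      "c \<in> new_negConj X D (stage X D n) \<longleftrightarrow> c \<in> new_negConj Y D (stage Y D n)"
      unfolding new_posConj_def new_negConj_def by auto
  qed
  with Suc new_agree[OF assms(1) Suc] show ?case
    unfolding agree_def by (simp add: Let_def)
qed (simp add: agree_def)

lemma limit_posO_agree: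
  assumes "stratified v D"
    and "\<And>c l q. c \<noteq> [] \<Longrightarrow> l \<in> set c \<Longrightarrow> v q < m \<Longrightarrow>
           q \<in> posO (X (conj_red D c l)) \<longleftrightarrow> q \<in> posO (Y (conj_red D c l))"
    and "v q \<le> m"
  shows "q \<in> posO (limit_stage X D) \<longleftrightarrow> q \<in> posO (limit_stage Y D)"
  using stage_agree[of v D m X Y] assms unfolding limit_stage_def agree_def by simp

lemma limit_stage_cong:
  assumes "\<And>c l. c \<noteq> [] \<Longrightarrow> l \<in> set c \<Longrightarrow> posO (X (conj_red D c l)) = posO (Y (conj_red D c l))"
  shows "limit_stage X D = limit_stage Y D"
proof -
  have "new_posConj X D E = new_posConj Y D E" "new_negConj X D E = new_negConj Y D E" for E
    unfolding new_posConj_def new_negConj_def using assms by auto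
  then have "stage X D n = stage Y D n" for n by (induction n) simp_all
  then show ?thesis by (simp add: limit_stage_def)
qed

theorem stratified_ex1_extension:
  fixes D :: "'a dtheory"
  assumes "stratified v D"
  shows "\<exists>!E. is_extension D E"
proof -
  note strat = stratified_iterated_reds[OF assms]
  note closed = iterated_reds.step
  define X :: "nat \<Rightarrow> 'a dtheory \<Rightarrow> 'a extension"
    where "X k = (limit_stage ^^ k) undefined" for k
  have XSuc: "X (Suc k) = limit_stage (X k)" for k by (simp add: X_def)
  have XX: "q \<in> posO (X k D') \<longleftrightarrow> q \<in> posO (X m D')"
    if "k \<le> m" "D' \<in> iterated_reds D" "v q < k" for k m D' q
    using that
  proof (induction k arbitrary: m D' q)
    case (Suc k)
    then obtain m' where m: "m = Suc m'" "k \<le> m'" by (cases m) auto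
    show ?case unfolding m XSuc
      by (rule limit_posO_agree[where v = v and m = k])
        (use Suc.prems in \<open>simp_all add: Suc.IH[OF m(2)] strat closed\<close>)
  qed simp
  define Y :: "'a dtheory \<Rightarrow> 'a extension"
    where "Y D' = undefined \<lparr>posO := {q. q \<in> posO (X (Suc (v q)) D')}\<rparr>" for D'
  have YX: "q \<in> posO (Y D') \<longleftrightarrow> q \<in> posO (X k D')" if "D' \<in> iterated_reds D" "v q < k" for D' q k
    using XX[of "Suc (v q)" k D' q] that by (simp add: Y_def)
  have fixY: "posO (limit_stage Y D') = posO (Y D')" if D': "D' \<in> iterated_reds D" for D'
  proof (rule set_eqI)
    fix q
    have "q \<in> posO (limit_stage Y D') \<longleftrightarrow> q \<in> posO (limit_stage (X (v q)) D')"
      by (rule limit_posO_agree[where v = v and m = "v q"])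
        (simp_all add: YX[where k = "v q"] D' strat closed)
    also have "\<dots> \<longleftrightarrow> q \<in> posO (Y D')" by (simp add: Y_def XSuc)
    finally show "q \<in> posO (limit_stage Y D') \<longleftrightarrow> q \<in> posO (Y D')" .
  qed
  have "limit_stage Y D' = limit_stage (limit_stage Y) D'" if "D' \<in> iterated_reds D" for D'
    by (rule limit_stage_cong) (simp add: that closed fixY)
  then have ex: "is_extension D (limit_stage Y D)" unfolding is_extension_def by blast
  have uniq: "E = E'" if E: "is_extension D E" and E': "is_extension D E'" for E E'
  proof -
    obtain Z where Z: "\<And>D'. D' \<in> iterated_reds D \<Longrightarrow> Z D' = limit_stage Z D'" "E = Z D"
      using E unfolding is_extension_def by blast
    obtain W where W: "\<And>D'. D' \<in> iterated_reds D \<Longrightarrow> W D' = limit_stage W D'" "E' = W D"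
      using E' unfolding is_extension_def by blast
    have "q \<in> posO (Z D') \<longleftrightarrow> q \<in> posO (W D')" if "D' \<in> iterated_reds D" "v q < k" for k D' q
      using that
    proof (induction k arbitrary: D' q)
      case (Suc k)
      have "q \<in> posO (limit_stage Z D') \<longleftrightarrow> q \<in> posO (limit_stage W D')"
        by (rule limit_posO_agree[where v = v and m = k]) (use Suc.prems in \<open>simp_all add: Suc.IH strat closed\<close>)
      then show ?case using Z(1) W(1) Suc.prems(1) by simp
    qed simp
    then have "posO (Z D') = posO (W D')" if "D' \<in> iterated_reds D" for D'
      using that by blast
    then have "limit_stage Z D = limit_stage W D"
      by (intro limit_stage_cong) (simp add: closed[OF iterated_reds.self])
    then show ?thesis using Z(1)[OF iterated_reds.self] W(1)[OF iterated_reds.self] Z(2) W(2) by simp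
  qed
  from ex uniq show ?thesis by blast
qed

end

theory Submission imports Defs begin

text \<open>
  All operators of the construction are monotone in the extension, so whatever has been derived by
  stage \<open>n\<close> is, up to the facts, derivable in one step from stage \<open>n\<close> itself. Two conflicting
  conclusions can thus be compared at a single stage. If that stage is coherent, no rule is both
  applicable and discarded in it, and the conditions for the positive and the negative conclusion
  exclude each other. If a literal and its complement are both derived, then every applicable
  rule for one of them is beaten by an applicable rule for the other; this yields an infinite
  ascending chain in the superiority relation, which is impossible since it is finite and acyclic.
\<close>

lemma compl_compl [simp]: "compl (compl l) = l"
  by (cases l) simp_all

definition ext_le :: "'a extension \<Rightarrow> 'a extension \<Rightarrow> bool" where
  "ext_le E E' \<longleftrightarrow>
     pos E \<subseteq> pos E' \<and> neg E \<subseteq> neg E' \<and> posO E \<subseteq> posO E' \<and> negO E \<subseteq> negO E' \<and>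
     posConj E \<subseteq> posConj E' \<and> negConj E \<subseteq> negConj E'"

lemma rule_status_mono:
  assumes "ext_le E E'"
  shows "body_applicable E r \<Longrightarrow> body_applicable E' r"
    and "body_discarded E r \<Longrightarrow> body_discarded E' r"
    and "applicable_at E r j \<Longrightarrow> applicable_at E' r j"
    and "discarded_at E r j \<Longrightarrow> discarded_at E' r j"
proof -
  show b: "body_applicable E r \<Longrightarrow> body_applicable E' r"
    using assms unfolding ext_le_def body_applicable_def by (meson subset_trans)
  show d: "body_discarded E r \<Longrightarrow> body_discarded E' r"
    using assms unfolding ext_le_def body_discarded_def by blast
  show "applicable_at E r j \<Longrightarrow> applicable_at E' r j"
    using assms b unfolding ext_le_def applicable_at_def by blast
  show "discarded_at E r j \<Longrightarrow> discarded_at E' r j"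
    using assms d unfolding ext_le_def discarded_at_def by blast
qed

text \<open>Applicability and discardedness occur only positively in the conditions, and neither
  \<open>superior D\<close> nor the reduct extensions given by \<open>X\<close> vary with
  \<open>E\<close>.\<close>

lemma new_mono:
  assumes "ext_le E E'"
  shows "new_pos D E \<subseteq> new_pos D E'" "new_neg D E \<subseteq> new_neg D E'"
    "new_posO D E \<subseteq> new_posO D E'" "new_negO D E \<subseteq> new_negO D E'"
    "new_posConj X D E \<subseteq> new_posConj X D E'" "new_negConj X D E \<subseteq> new_negConj X D E'"
proof -
  note m = rule_status_mono[OF assms]
  show "new_pos D E \<subseteq> new_pos D E'" unfolding new_pos_def using m(1,2) by blast
  show "new_neg D E \<subseteq> new_neg D E'" unfolding new_neg_def using m(1,2) by blast
  show "new_posO D E \<subseteq> new_posO D E'" unfolding new_posO_def using m(3,4) by blast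
  show "new_negO D E \<subseteq> new_negO D E'" unfolding new_negO_def using m(3,4) by blast
  show "new_posConj X D E \<subseteq> new_posConj X D E'"
    using assms unfolding ext_le_def new_posConj_def by blast
  show "new_negConj X D E \<subseteq> new_negConj X D E'"
    using assms unfolding ext_le_def new_negConj_def by blast
qed

lemma stage_le_Suc: "ext_le (stage X D n) (stage X D (Suc n))"
  by (auto simp: ext_le_def Let_def)

lemma stage_mono:
  assumes "m \<le> n"
  shows "ext_le (stage X D m) (stage X D n)"
  using assms
proof (induction rule: dec_induct)
  case (step n)
  then show ?case using stage_le_Suc[of X D n] unfolding ext_le_def by (meson subset_trans)
qed (simp add: ext_le_def)

lemma stage_subset_new:
  "pos (stage X D n) \<subseteq> facts D \<union> new_pos D (stage X D n)"
  "neg (stage X D n) \<subseteq> new_neg D (stage X D n)"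
  "posO (stage X D n) \<subseteq> new_posO D (stage X D n)"
  "negO (stage X D n) \<subseteq> new_negO D (stage X D n)"
  "posConj (stage X D n) \<subseteq> new_posConj X D (stage X D n)"
  "negConj (stage X D n) \<subseteq> new_negConj X D (stage X D n)"
proof (induction n)
  case (Suc n)
  note m = new_mono[OF stage_le_Suc[of X D n]]
  \<comment> \<open>Naming the stage lets the equations \<open>E\<close> split its components while
    \<open>E\<close> stays folded as the argument of the operators.\<close>
  define E where "E = stage X D (Suc n)"
  have E: "pos E = pos (stage X D n) \<union> new_pos D (stage X D n)"
    "neg E = neg (stage X D n) \<union> new_neg D (stage X D n)"
    "posO E = posO (stage X D n) \<union> new_posO D (stage X D n)"
    "negO E = negO (stage X D n) \<union> new_negO D (stage X D n)"
    "posConj E = posConj (stage X D n) \<union> new_posConj X D (stage X D n)"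
    "negConj E = negConj (stage X D n) \<union> new_negConj X D (stage X D n)"
    by (simp_all add: E_def Let_def)
  {
    case 1 then show ?case using Suc(1) m(1)[of D] unfolding E_def[symmetric] E by blast
  next
    case 2 then show ?case using Suc(2) m(2)[of D] unfolding E_def[symmetric] E by blast
  next
    case 3 then show ?case using Suc(3) m(3)[of D] unfolding E_def[symmetric] E by blast
  next
    case 4 then show ?case using Suc(4) m(4)[of D] unfolding E_def[symmetric] E by blast
  next
    case 5 then show ?case using Suc(5) m(5)[of X D] unfolding E_def[symmetric] E by blast
  next
    case 6 then show ?case using Suc(6) m(6)[of X D] unfolding E_def[symmetric] E by blast
  }
qed simp_all

text \<open>Each antecedent element, and each consequent entry before index \<open>j\<close>, is
  tested by the two notions in opposite components of one pair; for \<open>NotObl\<close> the roles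
  of \<open>posO\<close> and \<open>negO\<close> are swapped.\<close>

lemma coherent_not_applicable_discarded:
  assumes "coherent E"
  shows "body_applicable E r \<Longrightarrow> \<not> body_discarded E r"
    and "applicable_at E r j \<Longrightarrow> \<not> discarded_at E r j"
proof -
  show b: "body_applicable E r \<Longrightarrow> \<not> body_discarded E r"
    using assms unfolding coherent_def body_applicable_def body_discarded_def by blast
  show "applicable_at E r j \<Longrightarrow> \<not> discarded_at E r j"
    using assms b unfolding coherent_def applicable_at_def discarded_at_def by blast
qed

text \<open>An applicable supporter is not discarded, and an applicable attacker \<open>s\<close>
  must be beaten by an applicable, hence undiscarded, \<open>t\<close>. For conjunctions, both
  conditions consult the same \<open>X\<close>, so the reduct tests are exact negations.\<close>

lemma coherent_new_disjoint:
  assumes "coherent E"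
  shows "(facts D \<union> new_pos D E) \<inter> new_neg D E = {}"
    and "new_posO D E \<inter> new_negO D E = {}"
    and "new_posConj X D E \<inter> new_negConj X D E = {}"
proof -
  note nd = coherent_not_applicable_discarded[OF assms]
  show "(facts D \<union> new_pos D E) \<inter> new_neg D E = {}"
    unfolding new_pos_def new_neg_def using nd(1) by blast
  show "new_posO D E \<inter> new_negO D E = {}"
    unfolding new_posO_def new_negO_def using nd(2) by blast
  show "new_posConj X D E \<inter> new_negConj X D E = {}"
    using assms unfolding new_posConj_def new_negConj_def coherent_def by blast
qed

lemma coherent_stage: "coherent (stage X D n)"
proof (induction n)
  case (Suc n)
  note d = coherent_new_disjoint(1,2)[OF Suc, of D] coherent_new_disjoint(3)[OF Suc, of X D]
  note s = stage_subset_new[of X D n]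
  \<comment> \<open>Old members and additions alike are licensed by stage \<open>n\<close>, which is
    coherent by induction.\<close>
  have "pos (stage X D (Suc n)) \<subseteq> facts D \<union> new_pos D (stage X D n)"
    "neg (stage X D (Suc n)) \<subseteq> new_neg D (stage X D n)"
    "posO (stage X D (Suc n)) \<subseteq> new_posO D (stage X D n)"
    "negO (stage X D (Suc n)) \<subseteq> new_negO D (stage X D n)"
    "posConj (stage X D (Suc n)) \<subseteq> new_posConj X D (stage X D n)"
    "negConj (stage X D (Suc n)) \<subseteq> new_negConj X D (stage X D n)"
    using s by (simp_all add: Let_def)
  with d show ?case unfolding coherent_def by blast
qed (simp add: coherent_def)

lemma finite_acyclic_no_ascending_chain:
  assumes "finite S" "acyclic S" "a \<in> A"
    and step: "\<And>s. s \<in> A \<Longrightarrow> \<exists>t\<in>A. (t, s) \<in> S"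
  shows False
proof -
  \<comment> \<open>As pairs list the superior element first, a minimal element of \<open>A\<close>
    is one that nothing in \<open>A\<close> beats.\<close>
  have "wf S" using assms(1,2) by (rule finite_acyclic_wf)
  then obtain z where "z \<in> A" "\<And>y. (y, z) \<in> S \<Longrightarrow> y \<notin> A"
    using assms(3) by (metis wfE_min)
  with step show False by blast
qed

lemma consistent_stage:
  assumes fin: "finite (superior D)" and acyc: "acyclic (superior D)"
    and facts: "\<not> (\<exists>p. p \<in> facts D \<and> compl p \<in> facts D)"
  shows "consistent (stage X D n)"
proof -
  define E where "E = stage X D n"
  note nd = coherent_not_applicable_discarded[OF coherent_stage[of X D n], folded E_def]
  note s = stage_subset_new[of X D n, folded E_def]
  have "\<not> (p \<in> pos E \<and> compl p \<in> pos E)" for p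
  proof
    assume p: "p \<in> pos E \<and> compl p \<in> pos E"
    then have "p \<in> facts D \<union> new_pos D E" "compl p \<in> facts D \<union> new_pos D E" using s(1) by blast+
    \<comment> \<open>If one of the two were a fact, the other could be neither a fact nor in
      \<open>new_pos D E\<close>, which demands that its complement be no fact.\<close>
    then have new: "p \<in> new_pos D E" "compl p \<in> new_pos D E"
      using facts unfolding new_pos_def by auto
    \<comment> \<open>Rules for both literals are collected because the beater of a rule for one is
      a rule for the other; defeaters are included, since they may beat too.\<close>
    define A where "A = {r. body_applicable E r \<and>
      (r \<in> rules_for (constitutive (rules D)) p \<or> r \<in> rules_for (constitutive (rules D)) (compl p))}"
    have "rules_for (constitutive (defeasible (rules D))) p \<subseteq> rules_for (constitutive (rules D)) p"
      by (auto simp: rules_for_def rules_at_def constitutive_def defeasible_def)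
    then obtain a where "a \<in> A" using new(1) unfolding A_def new_pos_def by blast
    moreover have "\<exists>t\<in>A. (t, r) \<in> superior D" if "r \<in> A" for r
      using that new nd(1) unfolding A_def new_pos_def by auto
    ultimately show False using finite_acyclic_no_ascending_chain[OF fin acyc] by blast
  qed
  moreover have "\<not> (p \<in> posO E \<and> compl p \<in> posO E)" for p
  proof
    assume p: "p \<in> posO E \<and> compl p \<in> posO E"
    then have new: "p \<in> new_posO D E" "compl p \<in> new_posO D E" using s(3) by blast+
    \<comment> \<open>The index is existential since a beater may apply at a different index from
      the rule it beats.\<close>
    define A where "A = {r. \<exists>j. applicable_at E r j \<and>
      (r \<in> rules_at (prescriptive (rules D)) p j \<or>
       r \<in> rules_at (prescriptive (rules D)) (compl p) j)}"
    have "rules_at (prescriptive (defeasible (rules D))) p j \<subseteq> rules_at (prescriptive (rules D)) p j"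
      for j by (auto simp: rules_at_def prescriptive_def defeasible_def)
    then obtain a where "a \<in> A" using new(1) unfolding A_def new_posO_def by blast
    moreover have "\<exists>t\<in>A. (t, r) \<in> superior D" if r: "r \<in> A" for r
    proof -
      have beat: "\<exists>t i. t \<in> rules_at (prescriptive (rules D)) q i \<and> applicable_at E t i \<and>
          (t, r) \<in> superior D"
        if "q \<in> new_posO D E" "r \<in> rules_at (prescriptive (rules D)) (compl q) j"
          "applicable_at E r j" for q j
        using that nd(2) unfolding new_posO_def by blast
      from r show ?thesis
        using beat[OF new(1)] beat[OF new(2)] unfolding A_def by auto blast+
    qed
    ultimately show False using finite_acyclic_no_ascending_chain[OF fin acyc] by blast
  qed
  ultimately show ?thesis unfolding consistent_def E_def by blast
qed

text \<open>Two members of a limit may enter at different stages; this brings them into one.\<close>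

lemma stage_common:
  "\<exists>k. ext_le (stage X D m) (stage X D k) \<and> ext_le (stage X D n) (stage X D k)"
  using stage_mono[of m "max m n" X D] stage_mono[of n "max m n" X D] by auto

lemma coherent_limit_stage: "coherent (limit_stage X D)"
proof -
  have "False" if "x \<in> pos (stage X D m) \<and> x \<in> neg (stage X D n) \<or>
      x \<in> posO (stage X D m) \<and> x \<in> negO (stage X D n) \<or>
      c \<in> posConj (stage X D m) \<and> c \<in> negConj (stage X D n)" for x c m n
  proof -
    obtain k where "ext_le (stage X D m) (stage X D k)" "ext_le (stage X D n) (stage X D k)"
      using stage_common by blast
    with that coherent_stage[of X D k] show False unfolding ext_le_def coherent_def by blast
  qed
  then show ?thesis unfolding coherent_def limit_stage_def by auto
qed

lemma consistent_limit_stage: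
  assumes "\<And>n. consistent (stage X D n)"
  shows "consistent (limit_stage X D)"
proof -
  have "False" if "p \<in> pos (stage X D m) \<and> compl p \<in> pos (stage X D n) \<or>
      p \<in> posO (stage X D m) \<and> compl p \<in> posO (stage X D n)" for p m n
  proof -
    obtain k where "ext_le (stage X D m) (stage X D k)" "ext_le (stage X D n) (stage X D k)"
      using stage_common by blast
    with that assms[of k] show False unfolding ext_le_def consistent_def by blast
  qed
  then show ?thesis unfolding consistent_def limit_stage_def by auto
qed

theorem mainTheorem2:
  fixes D :: "'a dtheory" and E :: "'a extension"
  assumes "defeasible_theory D"
    and "is_extension D E"
  shows "coherent E \<and>
    (\<not> (\<exists>p. p \<in> facts D \<and> compl p \<in> facts D) \<and> acyclic ((superior D)\<^sup>+) \<longrightarrow> consistent E)"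
proof -
  \<comment> \<open>The defining equation at \<open>D\<close> itself presents \<open>E\<close> as a
    limit of stages; the lemmas on limits hold for any \<open>X\<close>.\<close>
  obtain X where E: "E = limit_stage X D"
    using assms(2) iterated_reds.self unfolding is_extension_def by metis
  have "finite (superior D)"
    using assms(1) unfolding defeasible_theory_def by (meson finite_SigmaI finite_subset)
  moreover have "acyclic ((superior D)\<^sup>+) \<Longrightarrow> acyclic (superior D)"
    unfolding acyclic_def by simp
  ultimately show ?thesis
    unfolding E using coherent_limit_stage consistent_limit_stage consistent_stage by blast
qed

end
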